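(* Let $\Lambda$ be a measurable cardinal and $\mathcal U$ a non-principal $\Lambda$-complete ultrafilter on $\Lambda$. Let $(H_\lambda)_{\lambda\in\Lambda}$ be a family of commutative cancellative monoids such that for every $\lambda\in\Lambda$ the following holds: for every multiset $L\subseteq\mathbb N_{\ge2}$ with $\#_L(\ell)<\Lambda$ for all $\ell\in\mathbb N_{\ge2}$, there exists $r_\lambda\in H_\lambda$ such that for all $\ell\in\mathbb N_{\ge2}$ we have $\#_{L(r_\lambda)}(\ell)\ge\#_L(\ell)$ and, if $\#_L(\ell)$ is finite, $\#_{L(r_\lambda)}(\ell)=\#_L(\ell)$. Then, for every multiset $L\subseteq\mathbb N_{\ge2}$ such that for all $\ell\in\mathbb N_{\ge2}$ the multiplicity $\#_L(\ell)\le\Lambda$ is either finite or countable or a limit cardinal, there exists $r^*$ in the ultraproduct $H^*=\prod^{\mathcal U}_{\lambda\in\Lambda}H_\lambda$ such that for all $\ell\in\mathbb N_{\ge2}$: (i) $\#_{L(r^* )}(\ell)\ge\#_L(\ell)$, and (ii) if $\#_L(\ell)$ is finite then $\#_{L(r^* )}(\ell)=\#_L(\ell)$.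
   Context: An ultrafilter $\mathcal U$ is $\kappa$-complete (for a cardinal $\kappa$) if $\bigcap_{i\in I}U_i\in\mathcal U$ for every family $(U_i)_{i\in I}$ of members of $\mathcal U$ with $|I|<\kappa$. A cardinal $\kappa$ is measurable if there exists a non-principal $\kappa$-complete ultrafilter on $\kappa$ (so $\aleph_0$ is measurable in this sense). A limit cardinal is a cardinal $\aleph_\delta$ with $\delta$ a non-zero limit ordinal. A multiset $L\subseteq\mathbb N_{\ge2}$ assigns to each integer $\ell\ge2$ a cardinal $\#_L(\ell)$, its multiplicity. For a commutative cancellative monoid $M$ (written multiplicatively), $M^\times$ is its group of units. An atom of $M$ is a non-unit $a$ such that $a=bc$ with $b,c\in M$ implies $b\in M^\times$ or $c\in M^\times$. Elements $a,b$ are associated if $a=\varepsilon b$ for some $\varepsilon\in M^\times$. A factorization of $a\in M$ of length $\ell$ is an expression $a=u_1\cdots u_\ell$ with atoms $u_i$. Two factorizations $u_1\cdots u_n$ and $v_1\cdots v_m$ are essentially the same if $n=m$ and, for some permutation $\sigma$, $u_i$ is associated to $v_{\sigma(i)}$ for all $i$. The multiset of lengths $L(a)$ of $a\in M$ is the multiset in which $\#_{L(a)}(\ell)$ is the cardinality of the set of classes, modulo being essentially the same, of factorizations of $a$ of length $\ell$. The ultraproduct $H^*$ is the quotient of $\prod_\lambda H_\lambda$ by the relation $r\equiv s\iff\{\lambda\mid r_\lambda=s_\lambda\}\in\mathcal U$, with componentwise multiplication; it is again a commutative cancellative monoid, and $r^*$ denotes the class of $r$. *)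

theory Defs
  imports
    "HOL-Library.Countable_Set"
    "HOL-Algebra.Divisibility"
    "HOL-Algebra.Product_Groups"
begin

unbundle cardinal_syntax

section \<open>Limit cardinals\<close>

definition limit_ordinal :: "'d rel \<Rightarrow> bool" where
  "limit_ordinal \<delta> \<longleftrightarrow> Well_order \<delta> \<and> Field \<delta> \<noteq> {} \<and>
     (\<forall>i\<in>Field \<delta>. \<exists>j\<in>Field \<delta>. i \<noteq> j \<and> (i, j) \<in> \<delta>)"

text \<open>
  \<open>is_aleph \<delta> \<kappa>\<close> says that \<open>\<kappa>\<close> is the cardinal aleph-\<open>\<delta>\<close>: it is infinite, and the infinite
  cardinals below it are enumerated in strictly increasing order by the ordinal \<open>\<delta>\<close>.
  Every cardinal below \<open>\<kappa>\<close> has a representative on the type of \<open>\<kappa>\<close>, so it is enough to let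
  \<open>\<mu>\<close> range over relations on that type.
\<close>

definition is_aleph :: "'d rel \<Rightarrow> 'k rel \<Rightarrow> bool" where
  "is_aleph \<delta> \<kappa> \<longleftrightarrow> Well_order \<delta> \<and> Card_order \<kappa> \<and> infinite (Field \<kappa>) \<and>
     (\<exists>f :: 'd \<Rightarrow> 'k rel.
        (\<forall>i\<in>Field \<delta>. Card_order (f i) \<and> infinite (Field (f i)) \<and> f i <o \<kappa>) \<and>
        (\<forall>i\<in>Field \<delta>. \<forall>j\<in>Field \<delta>. i \<noteq> j \<and> (i, j) \<in> \<delta> \<longrightarrow> f i <o f j) \<and>
        (\<forall>\<mu> :: 'k rel. Card_order \<mu> \<and> infinite (Field \<mu>) \<and> \<mu> <o \<kappa> \<longrightarrow>
           (\<exists>i\<in>Field \<delta>. \<mu> =o f i)))"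

text \<open>
  If \<open>\<kappa>\<close> is aleph-\<open>\<delta>\<close>, then \<open>\<delta>\<close> is at most \<open>\<kappa>\<close>; hence \<open>\<delta>\<close> can be taken on the type of \<open>\<kappa>\<close>.
\<close>

definition limit_cardinal :: "'k rel \<Rightarrow> bool" where
  "limit_cardinal \<kappa> \<longleftrightarrow> (\<exists>\<delta> :: 'k rel. limit_ordinal \<delta> \<and> is_aleph \<delta> \<kappa>)"

lemma infinite_Field_iff_natLeq:
  assumes "Card_order r"
  shows "infinite (Field r) \<longleftrightarrow> natLeq \<le>o r"
  using assms infinite_iff_natLeq_ordLeq[of "Field r"] card_of_Field_ordIso[of r]
    ordLeq_ordIso_trans ordIso_symmetric by blast

lemma limit_cardinal_iff:
  fixes \<kappa> :: "'k rel"
  assumes \<kappa>: "Card_order \<kappa>"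
  shows "limit_cardinal \<kappa> \<longleftrightarrow>
    natLeq <o \<kappa> \<and> (\<forall>\<mu> :: 'k rel. Card_order \<mu> \<and> \<mu> <o \<kappa> \<longrightarrow> cardSuc \<mu> <o \<kappa>)"
proof
  assume "limit_cardinal \<kappa>"
  then obtain \<delta> :: "'k rel" where \<delta>: "limit_ordinal \<delta>" and al: "is_aleph \<delta> \<kappa>"
    unfolding limit_cardinal_def by blast
  from al obtain f :: "'k \<Rightarrow> 'k rel" where
    f1': "\<forall>i\<in>Field \<delta>. Card_order (f i) \<and> infinite (Field (f i)) \<and> f i <o \<kappa>" and
    f2': "\<forall>i\<in>Field \<delta>. \<forall>j\<in>Field \<delta>. i \<noteq> j \<and> (i, j) \<in> \<delta> \<longrightarrow> f i <o f j" and
    f3': "\<forall>\<mu> :: 'k rel. Card_order \<mu> \<and> infinite (Field \<mu>) \<and> \<mu> <o \<kappa> \<longrightarrow>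
             (\<exists>i\<in>Field \<delta>. \<mu> =o f i)"
    unfolding is_aleph_def by (elim conjE exE)
  note f1 = f1'[rule_format] and f2 = f2'[rule_format, OF _ _ conjI]
    and f3 = f3'[rule_format, OF conjI, OF _ conjI]
  from \<delta> obtain i0 where i0: "i0 \<in> Field \<delta>" unfolding limit_ordinal_def by blast
  have nat: "natLeq <o \<kappa>"
    using f1[OF i0] infinite_Field_iff_natLeq ordLeq_ordLess_trans by blast
  moreover have "cardSuc \<mu> <o \<kappa>" if \<mu>: "Card_order \<mu>" "\<mu> <o \<kappa>" for \<mu> :: "'k rel"
  proof (cases "finite (Field \<mu>)")
    case True
    have "\<not> natLeq \<le>o \<mu>" using True infinite_Field_iff_natLeq[OF \<mu>(1)] by blast
    then have "\<mu> <o natLeq"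
      using \<mu>(1) natLeq_Well_order not_ordLeq_iff_ordLess[of \<mu> natLeq]
      unfolding card_order_on_def by blast
    then have "cardSuc \<mu> \<le>o natLeq" using cardSuc_least[OF \<mu>(1) natLeq_Card_order] by blast
    then show ?thesis using nat ordLeq_ordLess_trans by blast
  next
    case False
    obtain i where i: "i \<in> Field \<delta>" "\<mu> =o f i" using f3[OF \<mu>(1) False \<mu>(2)] by blast
    obtain j where j: "j \<in> Field \<delta>" "i \<noteq> j" "(i, j) \<in> \<delta>"
      using \<delta> i(1) unfolding limit_ordinal_def by blast
    have "\<mu> <o f j" using f2[OF i(1) j] i(2) ordIso_ordLess_trans by blast
    then have "cardSuc \<mu> \<le>o f j" using cardSuc_least[OF \<mu>(1)] f1[OF j(1)] by blast
    then show ?thesis using f1[OF j(1)] ordLeq_ordLess_trans by blast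
  qed
  ultimately show "natLeq <o \<kappa> \<and>
      (\<forall>\<mu> :: 'k rel. Card_order \<mu> \<and> \<mu> <o \<kappa> \<longrightarrow> cardSuc \<mu> <o \<kappa>)" by blast
next
  assume R: "natLeq <o \<kappa> \<and> (\<forall>\<mu> :: 'k rel. Card_order \<mu> \<and> \<mu> <o \<kappa> \<longrightarrow> cardSuc \<mu> <o \<kappa>)"
  have wo: "Well_order \<kappa>" using \<kappa> unfolding card_order_on_def by blast
  have w: "wo_rel \<kappa>" using wo by (simp add: wo_rel_def)
  define f where "f a = Restr \<kappa> (underS \<kappa> a)" for a
  define D where "D = {a \<in> Field \<kappa>. Card_order (f a) \<and> infinite (Field (f a))}"
  define \<delta> where "\<delta> = Restr \<kappa> D"
  have D: "D \<subseteq> Field \<kappa>" unfolding D_def by blast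
  have Fd: "Field \<delta> = D"
    unfolding \<delta>_def using wo D Refl_Field_Restr2[of \<kappa> D]
    by (simp add: order_on_defs)
  have wd: "Well_order \<delta>" unfolding \<delta>_def by (rule Well_order_Restr[OF wo])
  have less: "f a <o \<kappa>" if "a \<in> Field \<kappa>" for a
    unfolding f_def using underS_Restr_ordLess[OF wo] that by blast
  have mono: "f a <o f b" if "a \<in> Field \<kappa>" "b \<in> Field \<kappa>" "a \<noteq> b" "(a, b) \<in> \<kappa>" for a b
  proof -
    have "a \<in> underS \<kappa> b" using that unfolding underS_def by blast
    moreover have "a \<notin> underS \<kappa> a" unfolding underS_def by blast
    moreover have "underS \<kappa> a \<subseteq> underS \<kappa> b"
      using underS_incr[of \<kappa> a b] wo_rel.TRANS[OF w] wo_rel.ANTISYM[OF w] that(4) by blast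
    ultimately have "underS \<kappa> a \<subset> underS \<kappa> b" by blast
    moreover have "ofilter \<kappa> (underS \<kappa> a)" "ofilter \<kappa> (underS \<kappa> b)"
      using wo_rel.underS_ofilter[OF w] by blast+
    ultimately show ?thesis
      unfolding f_def using ofilter_subset_ordLess[OF wo] by blast
  qed
  have ex: "\<exists>a\<in>D. \<mu> =o f a" if m: "Card_order \<mu>" "natLeq \<le>o \<mu>" "\<mu> <o \<kappa>" for \<mu> :: "'c rel"
  proof -
    have "Well_order \<mu>" using m(1) unfolding card_order_on_def by blast
    then obtain a where a: "a \<in> Field \<kappa>" "\<mu> =o f a"
      using ordLess_iff_ordIso_Restr[OF wo] m(3) unfolding f_def by blast
    have "Card_order (f a)" using Card_order_ordIso2[OF m(1) a(2)] .
    moreover have "natLeq \<le>o f a" using m(2) a(2) ordLeq_ordIso_trans by blast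
    ultimately show ?thesis
      using a infinite_Field_iff_natLeq unfolding D_def by blast
  qed
  have ne: "D \<noteq> {}"
    using ex[OF natLeq_Card_order] R natLeq_Well_order ordLeq_reflexive by blast
  have nomax: "\<exists>j\<in>D. i \<noteq> j \<and> (i, j) \<in> \<kappa>" if i: "i \<in> D" for i
  proof -
    have Ci: "Card_order (f i)" "infinite (Field (f i))" "i \<in> Field \<kappa>" "f i <o \<kappa>"
      using i less unfolding D_def by blast+
    have gt: "f i <o cardSuc (f i)" using cardSuc_greater[OF Ci(1)] .
    have "natLeq \<le>o f i" using Ci infinite_Field_iff_natLeq by blast
    then have "natLeq \<le>o cardSuc (f i)" using gt ordLeq_transitive ordLess_imp_ordLeq by blast
    then obtain j where j: "j \<in> D" "cardSuc (f i) =o f j"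
      using ex[OF cardSuc_Card_order[OF Ci(1)]] R Ci by blast
    have ij: "f i <o f j" using gt j(2) ordLess_ordIso_trans by blast
    have jF: "j \<in> Field \<kappa>" using j(1) D by blast
    have "i \<noteq> j" using ij ordLess_irreflexive by blast
    moreover have "(j, i) \<notin> \<kappa>"
      using mono[OF jF Ci(3)] ij \<open>i \<noteq> j\<close> ordLess_transitive ordLess_irreflexive by blast
    ultimately show ?thesis
      using j(1) Ci(3) jF wo_rel.TOTALS[OF w] by blast
  qed
  have "limit_ordinal \<delta>"
    unfolding limit_ordinal_def Fd using wd[unfolded Fd] ne nomax unfolding \<delta>_def by fast
  moreover have "is_aleph \<delta> \<kappa>"
    unfolding is_aleph_def Fd
  proof (intro conjI exI[of _ f] wd[unfolded Fd] \<kappa> ballI allI impI)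
    show "infinite (Field \<kappa>)"
      using R infinite_Field_iff_natLeq[OF \<kappa>] ordLess_imp_ordLeq by blast
  next
    fix i assume "i \<in> D"
    then show "Card_order (f i)" "infinite (Field (f i))" "f i <o \<kappa>"
      using less unfolding D_def by blast+
  next
    fix i j assume "i \<in> D" "j \<in> D" "i \<noteq> j \<and> (i, j) \<in> \<delta>"
    then show "f i <o f j" using mono D unfolding \<delta>_def by blast
  next
    fix \<mu> :: "'k rel" assume "Card_order \<mu> \<and> infinite (Field \<mu>) \<and> \<mu> <o \<kappa>"
    then show "\<exists>i\<in>D. \<mu> =o f i" using ex infinite_Field_iff_natLeq by blast
  qed
  ultimately show "limit_cardinal \<kappa>" unfolding limit_cardinal_def by blast
qed

section \<open>Ultrafilters and measurable cardinals\<close>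

definition ultrafilter_on :: "'i set \<Rightarrow> 'i set set \<Rightarrow> bool" where
  "ultrafilter_on X \<U> \<longleftrightarrow> \<U> \<subseteq> Pow X \<and> X \<in> \<U> \<and> {} \<notin> \<U> \<and>
     (\<forall>A\<in>\<U>. \<forall>B\<in>\<U>. A \<inter> B \<in> \<U>) \<and>
     (\<forall>A\<in>\<U>. \<forall>B. A \<subseteq> B \<and> B \<subseteq> X \<longrightarrow> B \<in> \<U>) \<and>
     (\<forall>A. A \<subseteq> X \<longrightarrow> A \<in> \<U> \<or> X - A \<in> \<U>)"

definition nonprincipal_on :: "'i set \<Rightarrow> 'i set set \<Rightarrow> bool" where
  "nonprincipal_on X \<U> \<longleftrightarrow> \<not> (\<exists>x\<in>X. \<U> = {A. A \<subseteq> X \<and> x \<in> A})"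

text \<open>
  A family of fewer than \<open>\<kappa>\<close> members of \<open>\<U>\<close> has the same intersection as its range, so families
  are represented by subsets of \<open>\<U>\<close>. Intersecting with \<open>X\<close> matters only for the empty family,
  where \<open>\<Inter>{} = UNIV\<close>.
\<close>

definition complete_on :: "'i set \<Rightarrow> 'k rel \<Rightarrow> 'i set set \<Rightarrow> bool" where
  "complete_on X \<kappa> \<U> \<longleftrightarrow> (\<forall>\<F>. \<F> \<subseteq> \<U> \<and> |\<F>| <o \<kappa> \<longrightarrow> X \<inter> \<Inter>\<F> \<in> \<U>)"

text \<open>
  The order \<open>\<kappa>\<close> represents the cardinal, and its field serves as the underlying set.
\<close>

definition measurable_cardinal :: "'k rel \<Rightarrow> bool" where
  "measurable_cardinal \<kappa> \<longleftrightarrow> Card_order \<kappa> \<and>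
     (\<exists>\<U>. ultrafilter_on (Field \<kappa>) \<U> \<and> nonprincipal_on (Field \<kappa>) \<U> \<and>
          complete_on (Field \<kappa>) \<kappa> \<U>)"

section \<open>Multisets of lengths\<close>

text \<open>
  Atoms are the \<open>irreducible\<close> elements of the library; the two lemmas below show that, in a
  commutative cancellative monoid, \<open>irreducible\<close> and \<open>associated\<close> have their usual
  descriptions through products and units.
\<close>

lemma (in comm_monoid_cancel) irreducible_iff_atom:
  assumes a: "a \<in> carrier G"
  shows "irreducible G a \<longleftrightarrow> a \<notin> Units G \<and>
    (\<forall>b\<in>carrier G. \<forall>c\<in>carrier G. a = b \<otimes> c \<longrightarrow> b \<in> Units G \<or> c \<in> Units G)"
proof
  assume irr: "irreducible G a"
  show "a \<notin> Units G \<and>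
    (\<forall>b\<in>carrier G. \<forall>c\<in>carrier G. a = b \<otimes> c \<longrightarrow> b \<in> Units G \<or> c \<in> Units G)"
  proof (intro conjI ballI impI)
    show "a \<notin> Units G" using irr unfolding irreducible_def by blast
    fix b c assume bc: "b \<in> carrier G" "c \<in> carrier G" "a = b \<otimes> c"
    show "b \<in> Units G \<or> c \<in> Units G"
    proof (rule disjCI)
      assume c: "c \<notin> Units G"
      have "properfactor G b a" using properfactorI3[OF bc(3) c bc(1,2)] .
      then show "b \<in> Units G" using irr bc(1) unfolding irreducible_def by blast
    qed
  qed
next
  assume R: "a \<notin> Units G \<and>
    (\<forall>b\<in>carrier G. \<forall>c\<in>carrier G. a = b \<otimes> c \<longrightarrow> b \<in> Units G \<or> c \<in> Units G)"
  show "irreducible G a"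
    unfolding irreducible_def
  proof (intro conjI ballI impI)
    show "a \<notin> Units G" using R by blast
    fix b assume b: "b \<in> carrier G" "properfactor G b a"
    then obtain c where c: "c \<in> carrier G" "a = b \<otimes> c"
      unfolding properfactor_def factor_def by blast
    have "c \<notin> Units G"
      using associatedI2[of c a b] b c m_comm associated_sym
      unfolding properfactor_def associated_def by blast
    then show "b \<in> Units G" using R b(1) c by blast
  qed
qed

lemma (in comm_monoid_cancel) associated_iff_unit:
  assumes "a \<in> carrier G" "b \<in> carrier G"
  shows "a \<sim> b \<longleftrightarrow> (\<exists>\<epsilon>\<in>Units G. a = \<epsilon> \<otimes> b)"
  using assms associated_iff[of a b] m_comm Units_closed by metis

definition factorizations :: "('a, 'm) monoid_scheme \<Rightarrow> 'a \<Rightarrow> nat \<Rightarrow> 'a list set" where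
  "factorizations G a n = {us. set us \<subseteq> carrier G \<and> length us = n \<and> factors G us a}"

definition same_factorization ::
  "('a, 'm) monoid_scheme \<Rightarrow> 'a \<Rightarrow> nat \<Rightarrow> 'a list rel" where
  "same_factorization G a n =
     {(us, vs) \<in> factorizations G a n \<times> factorizations G a n. essentially_equal G us vs}"

text \<open>
  Multiplicities are cardinals, represented as in the library by cardinal orders. Accordingly a
  multiset of lengths with multiplicities at most a cardinal \<open>\<kappa> :: 'k rel\<close> is a function
  \<open>L :: nat \<Rightarrow> 'k rel\<close> whose values at the arguments from 2 on are cardinal orders: every cardinal
  up to \<open>\<kappa>\<close> has a representative on \<open>'k\<close>.
\<close>

definition length_multiplicity ::
  "('a, 'm) monoid_scheme \<Rightarrow> 'a \<Rightarrow> nat \<Rightarrow> 'a list set rel" where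
  "length_multiplicity G a n = |factorizations G a n // same_factorization G a n|"

lemma (in comm_monoid_cancel) equiv_same_factorization:
  "equiv (factorizations G a n) (same_factorization G a n)"
proof (rule equivI)
  show "refl_on (factorizations G a n) (same_factorization G a n)"
    unfolding refl_on_def same_factorization_def factorizations_def by auto
  show "sym (same_factorization G a n)"
    unfolding sym_def same_factorization_def factorizations_def
    by (auto intro: ee_sym)
  show "trans (same_factorization G a n)"
    unfolding trans_def same_factorization_def factorizations_def
    by (auto intro: ee_trans)
  show "same_factorization G a n \<subseteq> factorizations G a n \<times> factorizations G a n"
    unfolding same_factorization_def by blast
qed

section \<open>Ultraproducts of monoids\<close>

text \<open>
  Despite its name, \<open>product_group\<close> is the componentwise product of an arbitrary family of
  monoids.
\<close>

definition ultra_rel ::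
  "'i set \<Rightarrow> 'i set set \<Rightarrow> ('i \<Rightarrow> ('a, 'm) monoid_scheme) \<Rightarrow> ('i \<Rightarrow> 'a) rel" where
  "ultra_rel X \<U> H =
     {(r, s) \<in> carrier (product_group X H) \<times> carrier (product_group X H).
        {i \<in> X. r i = s i} \<in> \<U>}"

definition ultraproduct ::
  "'i set \<Rightarrow> 'i set set \<Rightarrow> ('i \<Rightarrow> ('a, 'm) monoid_scheme) \<Rightarrow> ('i \<Rightarrow> 'a) set monoid" where
  "ultraproduct X \<U> H =
     \<lparr>carrier = carrier (product_group X H) // ultra_rel X \<U> H,
      monoid.mult = (\<lambda>R S. \<Union>r\<in>R. \<Union>s\<in>S. ultra_rel X \<U> H `` {r \<otimes>\<^bsub>product_group X H\<^esub> s}),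
      one = ultra_rel X \<U> H `` {\<one>\<^bsub>product_group X H\<^esub>}\<rparr>"

lemma equiv_ultra_rel:
  assumes "ultrafilter_on X \<U>"
  shows "equiv (carrier (product_group X H)) (ultra_rel X \<U> H)"
proof (rule equivI)
  show "ultra_rel X \<U> H \<subseteq> carrier (product_group X H) \<times> carrier (product_group X H)"
    unfolding ultra_rel_def by blast
  show "refl_on (carrier (product_group X H)) (ultra_rel X \<U> H)"
    using assms unfolding refl_on_def ultra_rel_def ultrafilter_on_def by auto
  show "sym (ultra_rel X \<U> H)"
    unfolding sym_def ultra_rel_def by (auto simp: eq_commute)
  show "trans (ultra_rel X \<U> H)"
  proof (rule transI)
    fix r s t assume rs: "(r, s) \<in> ultra_rel X \<U> H" and st: "(s, t) \<in> ultra_rel X \<U> H"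
    have "{i \<in> X. r i = s i} \<inter> {i \<in> X. s i = t i} \<in> \<U>"
      using rs st assms unfolding ultra_rel_def ultrafilter_on_def by blast
    then have "{i \<in> X. r i = t i} \<in> \<U>"
      using assms unfolding ultrafilter_on_def
      by (elim conjE) (drule bspec, assumption, drule spec, erule mp, auto)
    then show "(r, t) \<in> ultra_rel X \<U> H" using rs st unfolding ultra_rel_def by blast
  qed
qed

lemma ultraproduct_mult_class:
  assumes U: "ultrafilter_on X \<U>"
    and H: "\<And>i. i \<in> X \<Longrightarrow> monoid (H i)"
    and r: "r \<in> carrier (product_group X H)" and s: "s \<in> carrier (product_group X H)"
  shows "ultra_rel X \<U> H `` {r} \<otimes>\<^bsub>ultraproduct X \<U> H\<^esub> ultra_rel X \<U> H `` {s} =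
         ultra_rel X \<U> H `` {r \<otimes>\<^bsub>product_group X H\<^esub> s}"
proof -
  let ?R = "ultra_rel X \<U> H" and ?P = "product_group X H"
  note eqv = equiv_ultra_rel[OF U, of H]
  have closed: "a \<otimes>\<^bsub>?P\<^esub> b \<in> carrier ?P" if "a \<in> carrier ?P" "b \<in> carrier ?P" for a b
    using that H by (auto simp: PiE_iff intro: monoid.m_closed)
  have cong: "(r \<otimes>\<^bsub>?P\<^esub> s, a \<otimes>\<^bsub>?P\<^esub> b) \<in> ?R" if a: "(r, a) \<in> ?R" and b: "(s, b) \<in> ?R" for a b
  proof -
    have "{i \<in> X. r i = a i} \<inter> {i \<in> X. s i = b i} \<in> \<U>"
      using a b U unfolding ultra_rel_def ultrafilter_on_def by blast
    moreover have "{i \<in> X. r i = a i} \<inter> {i \<in> X. s i = b i} \<subseteq>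
        {i \<in> X. (r \<otimes>\<^bsub>?P\<^esub> s) i = (a \<otimes>\<^bsub>?P\<^esub> b) i}"
      by auto
    ultimately have "{i \<in> X. (r \<otimes>\<^bsub>?P\<^esub> s) i = (a \<otimes>\<^bsub>?P\<^esub> b) i} \<in> \<U>"
      using U unfolding ultrafilter_on_def by blast
    then show ?thesis
      using closed[OF r s] closed[of a b] a b unfolding ultra_rel_def by blast
  qed
  have cls: "?R `` {a \<otimes>\<^bsub>?P\<^esub> b} = ?R `` {r \<otimes>\<^bsub>?P\<^esub> s}"
    if "a \<in> ?R `` {r}" "b \<in> ?R `` {s}" for a b
  proof -
    have "(r, a) \<in> ?R" "(s, b) \<in> ?R" using that by blast+
    from equiv_class_eq[OF eqv cong[OF this]] show ?thesis by (rule sym)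
  qed
  have self: "r \<in> ?R `` {r}" "s \<in> ?R `` {s}"
    using equiv_class_self[OF eqv] r s by blast+
  have "?R `` {r} \<otimes>\<^bsub>ultraproduct X \<U> H\<^esub> ?R `` {s} =
      (\<Union>a\<in>?R `` {r}. \<Union>b\<in>?R `` {s}. ?R `` {a \<otimes>\<^bsub>?P\<^esub> b})"
    unfolding ultraproduct_def by (simp del: mult_product_group)
  also have "\<dots> = (\<Union>a\<in>?R `` {r}. \<Union>b\<in>?R `` {s}. ?R `` {r \<otimes>\<^bsub>?P\<^esub> s})"
    by (intro SUP_cong refl cls)
  also have "\<dots> = ?R `` {r \<otimes>\<^bsub>?P\<^esub> s}"
    using self by blast
  finally show ?thesis .
qed

lemma comm_monoid_cancel_ultraproduct:
  assumes U: "ultrafilter_on X \<U>" and H: "\<And>i. i \<in> X \<Longrightarrow> comm_monoid_cancel (H i)"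
  shows "comm_monoid_cancel (ultraproduct X \<U> H)"
proof -
  let ?R = "ultra_rel X \<U> H" and ?P = "product_group X H" and ?M = "ultraproduct X \<U> H"
  note eqv = equiv_ultra_rel[OF U, of H]
  have mon: "monoid (H i)" if "i \<in> X" for i
    using H[OF that] by (simp add: comm_monoid_cancel_def monoid_cancel_def)
  have com: "comm_monoid (H i)" if "i \<in> X" for i
    using H[OF that] by (simp add: comm_monoid_cancel_def)
  have can: "monoid_cancel (H i)" if "i \<in> X" for i
    using H[OF that] by (simp add: comm_monoid_cancel_def)
  have mult: "?R `` {a} \<otimes>\<^bsub>?M\<^esub> ?R `` {b} = ?R `` {a \<otimes>\<^bsub>?P\<^esub> b}"
    if "a \<in> carrier ?P" "b \<in> carrier ?P" for a b
    by (rule ultraproduct_mult_class[OF U mon that])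
  have P: "comm_monoid ?P"
  proof (rule comm_monoidI)
    show "\<one>\<^bsub>?P\<^esub> \<in> carrier ?P" using mon by (simp add: PiE_iff monoid.one_closed)
  next
    fix a b assume ab: "a \<in> carrier ?P" "b \<in> carrier ?P"
    show "a \<otimes>\<^bsub>?P\<^esub> b \<in> carrier ?P" using ab mon by (simp add: PiE_iff monoid.m_closed)
    show "a \<otimes>\<^bsub>?P\<^esub> b = b \<otimes>\<^bsub>?P\<^esub> a"
      using ab by (simp add: PiE_iff comm_monoid.m_comm[OF com] cong: restrict_cong)
  next
    fix a b c assume "a \<in> carrier ?P" "b \<in> carrier ?P" "c \<in> carrier ?P"
    then show "a \<otimes>\<^bsub>?P\<^esub> b \<otimes>\<^bsub>?P\<^esub> c = a \<otimes>\<^bsub>?P\<^esub> (b \<otimes>\<^bsub>?P\<^esub> c)"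
      by (simp add: PiE_iff monoid.m_assoc[OF mon] cong: restrict_cong)
  next
    fix a assume a: "a \<in> carrier ?P"
    then have "a = restrict a X" by (simp add: PiE_iff extensional_restrict)
    then show "\<one>\<^bsub>?P\<^esub> \<otimes>\<^bsub>?P\<^esub> a = a"
      using a by (simp add: PiE_iff monoid.l_one[OF mon] cong: restrict_cong)
  qed
  have carM: "carrier ?M = carrier ?P // ?R" and oneM: "\<one>\<^bsub>?M\<^esub> = ?R `` {\<one>\<^bsub>?P\<^esub>}"
    unfolding ultraproduct_def by simp_all
  have rep: "\<exists>r\<in>carrier ?P. A = ?R `` {r}" if "A \<in> carrier ?M" for A
    using that unfolding carM by (blast elim: quotientE)
  interpret P: comm_monoid ?P by (rule P)
  have M: "comm_monoid ?M"
  proof (rule comm_monoidI)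
    show "\<one>\<^bsub>?M\<^esub> \<in> carrier ?M" unfolding carM oneM by (rule quotientI[OF P.one_closed])
  next
    fix A B assume "A \<in> carrier ?M" "B \<in> carrier ?M"
    then obtain a b where ab: "a \<in> carrier ?P" "b \<in> carrier ?P" "A = ?R `` {a}" "B = ?R `` {b}"
      using rep by meson
    show "A \<otimes>\<^bsub>?M\<^esub> B \<in> carrier ?M"
      unfolding ab(3,4) mult[OF ab(1,2)] carM by (rule quotientI[OF P.m_closed[OF ab(1,2)]])
    show "A \<otimes>\<^bsub>?M\<^esub> B = B \<otimes>\<^bsub>?M\<^esub> A"
      unfolding ab(3,4) mult[OF ab(1,2)] mult[OF ab(2,1)] P.m_comm[OF ab(1,2)] by (rule refl)
  next
    fix A B C assume "A \<in> carrier ?M" "B \<in> carrier ?M" "C \<in> carrier ?M"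
    then obtain a b c where abc: "a \<in> carrier ?P" "b \<in> carrier ?P" "c \<in> carrier ?P"
      "A = ?R `` {a}" "B = ?R `` {b}" "C = ?R `` {c}"
      using rep by meson
    show "A \<otimes>\<^bsub>?M\<^esub> B \<otimes>\<^bsub>?M\<^esub> C = A \<otimes>\<^bsub>?M\<^esub> (B \<otimes>\<^bsub>?M\<^esub> C)"
      unfolding abc(4-6) mult[OF abc(1,2)] mult[OF abc(2,3)]
        mult[OF P.m_closed[OF abc(1,2)] abc(3)] mult[OF abc(1) P.m_closed[OF abc(2,3)]]
        P.m_assoc[OF abc(1-3)] by (rule refl)
  next
    fix A assume "A \<in> carrier ?M"
    then obtain a where a: "a \<in> carrier ?P" "A = ?R `` {a}" using rep by meson
    show "\<one>\<^bsub>?M\<^esub> \<otimes>\<^bsub>?M\<^esub> A = A"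
      unfolding oneM a(2) mult[OF P.one_closed a(1)] P.l_one[OF a(1)] by (rule refl)
  qed
  show ?thesis
  proof (rule comm_monoid_cancelI[OF M])
    fix A B C
    assume eq: "A \<otimes>\<^bsub>?M\<^esub> C = B \<otimes>\<^bsub>?M\<^esub> C"
      and "A \<in> carrier ?M" "B \<in> carrier ?M" "C \<in> carrier ?M"
    then obtain a b c where abc: "a \<in> carrier ?P" "b \<in> carrier ?P" "c \<in> carrier ?P"
      "A = ?R `` {a}" "B = ?R `` {b}" "C = ?R `` {c}"
      using rep by meson
    have "?R `` {a \<otimes>\<^bsub>?P\<^esub> c} = ?R `` {b \<otimes>\<^bsub>?P\<^esub> c}"
      using eq unfolding abc(4-6) mult[OF abc(1,3)] mult[OF abc(2,3)] .
    then have "(a \<otimes>\<^bsub>?P\<^esub> c, b \<otimes>\<^bsub>?P\<^esub> c) \<in> ?R"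
      by (rule eq_equiv_class[OF _ eqv P.m_closed[OF abc(2,3)]])
    then have "{i \<in> X. (a \<otimes>\<^bsub>?P\<^esub> c) i = (b \<otimes>\<^bsub>?P\<^esub> c) i} \<in> \<U>"
      unfolding ultra_rel_def by blast
    moreover have "{i \<in> X. (a \<otimes>\<^bsub>?P\<^esub> c) i = (b \<otimes>\<^bsub>?P\<^esub> c) i} = {i \<in> X. a i = b i}"
      using abc(1-3) monoid_cancel.r_cancel[OF can] by (auto simp: PiE_iff)
    ultimately have "(a, b) \<in> ?R" using abc(1,2) unfolding ultra_rel_def by auto
    then show "A = B" using equiv_class_eq[OF eqv] abc by blast
  qed
qed

end

theory Submission
  imports Defs
begin

text \<open>
  By a Los-type argument, divisibility, irreducibility, factorizations and essential equality in
  the ultraproduct hold if and only if they hold in almost all components; for essential equality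
  this uses that a list has only finitely many permutations. Hence sections of the sets of
  factorization classes of the \<open>H i\<close> yield factorization classes of the ultraproduct.
  For a multiplicity \<open>L n < \<Lambda>\<close> one prescribes \<open>L n\<close> in every component. For \<open>L n = \<Lambda>\<close> one
  prescribes in component \<open>i\<close> the cardinality of the set of predecessors of \<open>i\<close>: every fixed
  \<open>\<alpha> \<in> \<Lambda>\<close> precedes almost all \<open>i\<close>, so the constant sections give \<open>\<Lambda>\<close> distinct classes.
\<close>

section \<open>From ultrafilters to statements holding eventually\<close>

lemma ultrafilter_onD:
  assumes "ultrafilter_on X \<U>"
  shows "A \<in> \<U> \<Longrightarrow> A \<subseteq> X" "{} \<notin> \<U>"
    "A \<in> \<U> \<Longrightarrow> B \<in> \<U> \<Longrightarrow> A \<inter> B \<in> \<U>"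
    "A \<in> \<U> \<Longrightarrow> A \<subseteq> B \<Longrightarrow> B \<subseteq> X \<Longrightarrow> B \<in> \<U>"
    "A \<subseteq> X \<Longrightarrow> A \<in> \<U> \<or> X - A \<in> \<U>"
proof -
  have sub: "\<U> \<subseteq> Pow X" and emp: "{} \<notin> \<U>" and int: "\<forall>A\<in>\<U>. \<forall>B\<in>\<U>. A \<inter> B \<in> \<U>"
    and up: "\<forall>A\<in>\<U>. \<forall>B. A \<subseteq> B \<and> B \<subseteq> X \<longrightarrow> B \<in> \<U>"
    and compl: "\<forall>A. A \<subseteq> X \<longrightarrow> A \<in> \<U> \<or> X - A \<in> \<U>"
    using assms unfolding ultrafilter_on_def by simp_all
  show "A \<in> \<U> \<Longrightarrow> A \<subseteq> X"
    using sub by blast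
  show "{} \<notin> \<U>"
    by (rule emp)
  show "A \<in> \<U> \<Longrightarrow> B \<in> \<U> \<Longrightarrow> A \<inter> B \<in> \<U>"
    using int by simp
  show "A \<in> \<U> \<Longrightarrow> A \<subseteq> B \<Longrightarrow> B \<subseteq> X \<Longrightarrow> B \<in> \<U>"
    using up by blast
  show "A \<subseteq> X \<Longrightarrow> A \<in> \<U> \<or> X - A \<in> \<U>"
    using compl by simp
qed

text \<open>Phrasing membership in \<open>\<U>\<close> through the type of filters makes the rules
  for \<open>eventually\<close> available for "almost all components". Points outside
  \<open>X\<close> have no influence, although the filter lives on the whole type.\<close>

definition ultra_filter :: "'i set \<Rightarrow> 'i set set \<Rightarrow> 'i filter" where
  "ultra_filter X \<U> = Abs_filter (\<lambda>P. {i \<in> X. P i} \<in> \<U>)"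

lemma eventually_ultra_filter:
  assumes "ultrafilter_on X \<U>"
  shows "eventually P (ultra_filter X \<U>) \<longleftrightarrow> {i \<in> X. P i} \<in> \<U>"
  unfolding ultra_filter_def
proof (rule eventually_Abs_filter, rule is_filter.intro)
  show "{i \<in> X. True} \<in> \<U>"
    using assms by (simp add: ultrafilter_on_def)
next
  fix P Q
  assume "{i \<in> X. P i} \<in> \<U>" "{i \<in> X. Q i} \<in> \<U>"
  then have "{i \<in> X. P i} \<inter> {i \<in> X. Q i} \<in> \<U>"
    by (rule ultrafilter_onD(3)[OF assms])
  moreover have "{i \<in> X. P i} \<inter> {i \<in> X. Q i} = {i \<in> X. P i \<and> Q i}"
    by blast
  ultimately show "{i \<in> X. P i \<and> Q i} \<in> \<U>"
    by simp
next
  fix P Q :: "'a \<Rightarrow> bool"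
  assume "\<forall>x. P x \<longrightarrow> Q x" and P: "{i \<in> X. P i} \<in> \<U>"
  then have "{i \<in> X. P i} \<subseteq> {i \<in> X. Q i}" "{i \<in> X. Q i} \<subseteq> X"
    by auto
  then show "{i \<in> X. Q i} \<in> \<U>"
    by (rule ultrafilter_onD(4)[OF assms P])
qed

section \<open>Essential equality and irreducibility in transferable form\<close>

text \<open>The definition quantifies over an intermediate list. A permutation of positions in its
  place gives an existential over a finite set that depends only on the length and is therefore the
  same in every component.\<close>

lemma essentially_equal_iff_permutes:
  assumes "length us = n" "length vs = n"
  shows "essentially_equal G us vs \<longleftrightarrow>
    (\<exists>p\<in>{p. p permutes {..<n}}. \<forall>k\<in>{..<n}. us ! p k \<sim>\<^bsub>G\<^esub> vs ! k)"
proof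
  assume "essentially_equal G us vs"
  then obtain ws where ws: "mset us = mset ws" "list_all2 (associated G) ws vs"
    unfolding essentially_equal_def by blast
  obtain p where p: "p permutes {..<length us}" "permute_list p us = ws"
    using mset_eq_permutation[of ws us] ws(1) by auto
  have "us ! p k \<sim>\<^bsub>G\<^esub> vs ! k" if "k < n" for k
  proof -
    have "ws ! k = us ! p k"
      using permute_list_nth[OF p(1)] p(2) that assms by auto
    then show ?thesis
      using list_all2_nthD2[OF ws(2), of k] that assms by simp
  qed
  then show "\<exists>p\<in>{p. p permutes {..<n}}. \<forall>k\<in>{..<n}. us ! p k \<sim>\<^bsub>G\<^esub> vs ! k"
    using p(1) assms by auto
next
  assume "\<exists>p\<in>{p. p permutes {..<n}}. \<forall>k\<in>{..<n}. us ! p k \<sim>\<^bsub>G\<^esub> vs ! k"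
  then obtain p where p: "p permutes {..<length us}" "\<forall>k<n. us ! p k \<sim>\<^bsub>G\<^esub> vs ! k"
    using assms by auto
  have "mset us = mset (permute_list p us)"
    using p(1) by simp
  moreover have "list_all2 (associated G) (permute_list p us) vs"
    using p assms by (auto simp: list_all2_conv_all_nth permute_list_nth)
  ultimately show "essentially_equal G us vs"
    unfolding essentially_equal_def by blast
qed

text \<open>In a commutative monoid the units are the divisors of \<open>\<one>\<close>, so
  irreducibility becomes a formula in divisibility alone and can be transferred once divisibility
  is.\<close>

lemma (in comm_monoid) irreducible_iff_divides:
  assumes "a \<in> carrier G"
  shows "irreducible G a \<longleftrightarrow> \<not> a divides \<one> \<and>
    (\<forall>b\<in>carrier G. b divides a \<longrightarrow> a divides b \<or> b divides \<one>)"
  using assms unfolding irreducible_def properfactor_def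
  by (auto simp: Unit_eq_dividesone)

section \<open>Almost all components, and representatives of the ultraproduct\<close>

abbreviation factorization_classes :: "('a, 'm) monoid_scheme \<Rightarrow> 'a \<Rightarrow> nat \<Rightarrow> 'a list set set" where
  "factorization_classes K a n \<equiv> factorizations K a n // same_factorization K a n"

locale monoid_ultraproduct =
  fixes X :: "'i set" and \<U> :: "'i set set" and H :: "'i \<Rightarrow> ('a, 'm) monoid_scheme"
  assumes ultrafilter: "ultrafilter_on X \<U>"
    and factor_monoid: "i \<in> X \<Longrightarrow> comm_monoid_cancel (H i)"
begin

abbreviation "F \<equiv> ultra_filter X \<U>"
abbreviation "P \<equiv> product_group X H"
abbreviation "M \<equiv> ultraproduct X \<U> H"

definition cls :: "('i \<Rightarrow> 'a) \<Rightarrow> ('i \<Rightarrow> 'a) set" where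
  "cls r = ultra_rel X \<U> H `` {r}"

definition component :: "('i \<Rightarrow> 'a) list \<Rightarrow> 'i \<Rightarrow> 'a list" where
  "component ws i = map (\<lambda>r. r i) ws"

lemma eventually_F: "eventually Q F \<longleftrightarrow> {i \<in> X. Q i} \<in> \<U>"
  by (rule eventually_ultra_filter[OF ultrafilter])

lemma eventually_mem: "eventually (\<lambda>i. i \<in> X) F"
  using ultrafilter by (simp add: eventually_F ultrafilter_on_def)

lemma eventually_cong_mem:
  assumes "\<And>i. i \<in> X \<Longrightarrow> Q i \<longleftrightarrow> R i"
  shows "eventually Q F \<longleftrightarrow> eventually R F"
proof -
  have "{i \<in> X. Q i} = {i \<in> X. R i}"
    using assms by blast
  then show ?thesis
    by (simp add: eventually_F)
qed

text \<open>Maximality of \<open>\<U>\<close> puts a set or its complement into \<open>\<U>\<close>;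
  their disjointness excludes both. This is what lets negations, and hence universal quantifiers
  over elements, pass to the components.\<close>

lemma eventually_not: "eventually (\<lambda>i. \<not> Q i) F \<longleftrightarrow> \<not> eventually Q F"
proof -
  let ?A = "{i \<in> X. Q i}"
  have co: "{i \<in> X. \<not> Q i} = X - ?A"
    by blast
  have "?A \<in> \<U> \<or> X - ?A \<in> \<U>"
    by (rule ultrafilter_onD(5)[OF ultrafilter]) blast
  moreover have "\<not> (?A \<in> \<U> \<and> X - ?A \<in> \<U>)"
    using ultrafilter_onD(2,3)[OF ultrafilter] Diff_disjoint by metis
  ultimately show ?thesis
    unfolding eventually_F co by blast
qed

text \<open>Dual to the rule for finite conjunctions. It makes choices uniform: if almost every
  component picks one of finitely many candidates, a single candidate works in almost all
  components.\<close>

lemma eventually_bex_finite: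
  assumes "finite A"
  shows "eventually (\<lambda>i. \<exists>y\<in>A. Q i y) F \<longleftrightarrow> (\<exists>y\<in>A. eventually (\<lambda>i. Q i y) F)"
proof -
  have "eventually (\<lambda>i. \<exists>y\<in>A. Q i y) F \<longleftrightarrow> \<not> eventually (\<lambda>i. \<forall>y\<in>A. \<not> Q i y) F"
    unfolding eventually_not[symmetric] by simp
  also have "\<dots> \<longleftrightarrow> \<not> (\<forall>y\<in>A. \<not> eventually (\<lambda>i. Q i y) F)"
    unfolding eventually_ball_finite_distrib[OF assms] eventually_not ..
  finally show ?thesis
    by blast
qed

lemma monoid_H: "i \<in> X \<Longrightarrow> monoid (H i)"
  using factor_monoid by (simp add: comm_monoid_cancel_def monoid_cancel_def)

lemma comm_monoid_H: "i \<in> X \<Longrightarrow> comm_monoid (H i)"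
  using factor_monoid by (simp add: comm_monoid_cancel_def)

sublocale M: comm_monoid_cancel M
  by (rule comm_monoid_cancel_ultraproduct[OF ultrafilter factor_monoid])

lemma carrier_P_apply: "r \<in> carrier P \<Longrightarrow> i \<in> X \<Longrightarrow> r i \<in> carrier (H i)"
  by auto

lemma restrict_carrier_P: "(\<And>i. i \<in> X \<Longrightarrow> f i \<in> carrier (H i)) \<Longrightarrow> restrict f X \<in> carrier P"
  by simp

lemma one_closed_P: "\<one>\<^bsub>P\<^esub> \<in> carrier P"
  by (simp add: monoid.one_closed[OF monoid_H])

lemma m_closed_P: "r \<in> carrier P \<Longrightarrow> s \<in> carrier P \<Longrightarrow> r \<otimes>\<^bsub>P\<^esub> s \<in> carrier P"
  by (auto simp: PiE_iff intro: monoid.m_closed[OF monoid_H])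

lemma cls_closed: "r \<in> carrier P \<Longrightarrow> cls r \<in> carrier M"
  unfolding cls_def ultraproduct_def by (simp add: quotientI)

lemma cls_exhaust:
  assumes "A \<in> carrier M"
  obtains r where "r \<in> carrier P" "A = cls r"
  using assms unfolding cls_def ultraproduct_def by (auto elim: quotientE)

lemma carrier_M: "carrier M = cls ` carrier P"
  using cls_closed cls_exhaust by blast

lemma cls_eq_iff:
  assumes "r \<in> carrier P" "s \<in> carrier P"
  shows "cls r = cls s \<longleftrightarrow> eventually (\<lambda>i. r i = s i) F"
  using eq_equiv_class_iff[OF equiv_ultra_rel[OF ultrafilter] assms] assms
  unfolding cls_def eventually_F by (simp add: ultra_rel_def)

lemma cls_mult:
  assumes "r \<in> carrier P" "s \<in> carrier P"
  shows "cls r \<otimes>\<^bsub>M\<^esub> cls s = cls (r \<otimes>\<^bsub>P\<^esub> s)"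
  unfolding cls_def by (rule ultraproduct_mult_class[OF ultrafilter monoid_H assms])

lemma cls_one: "\<one>\<^bsub>M\<^esub> = cls \<one>\<^bsub>P\<^esub>"
  unfolding cls_def ultraproduct_def by simp

section \<open>Transfer of divisibility, atoms and factorizations\<close>

text \<open>Passing from the components to the ultraproduct is the direction that needs choice: the
  cofactors of the good components are assembled into one element of the product. Associatedness and
  irreducibility are transferred through this equivalence.\<close>

lemma cls_divides:
  assumes r: "r \<in> carrier P" and s: "s \<in> carrier P"
  shows "cls r divides\<^bsub>M\<^esub> cls s \<longleftrightarrow> eventually (\<lambda>i. r i divides\<^bsub>H i\<^esub> s i) F"
proof
  assume "cls r divides\<^bsub>M\<^esub> cls s"
  then obtain t where t: "t \<in> carrier P" "cls s = cls r \<otimes>\<^bsub>M\<^esub> cls t"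
    unfolding factor_def carrier_M by blast
  then have "eventually (\<lambda>i. s i = (r \<otimes>\<^bsub>P\<^esub> t) i) F"
    using r s m_closed_P by (simp add: cls_mult cls_eq_iff del: mult_product_group carrier_product_group)
  with eventually_mem show "eventually (\<lambda>i. r i divides\<^bsub>H i\<^esub> s i) F"
  proof eventually_elim
    case (elim i)
    then show ?case
      using carrier_P_apply[OF t(1)] unfolding factor_def by auto
  qed
next
  assume ev: "eventually (\<lambda>i. r i divides\<^bsub>H i\<^esub> s i) F"
  \<comment> \<open>Where divisibility fails the cofactor is set to \<open>\<one>\<close>, which
    keeps \<open>t\<close> in the carrier of the product.\<close>
  define t where "t = (\<lambda>i\<in>X. if r i divides\<^bsub>H i\<^esub> s i
    then SOME c. c \<in> carrier (H i) \<and> s i = r i \<otimes>\<^bsub>H i\<^esub> c else \<one>\<^bsub>H i\<^esub>)"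
  have t: "t i \<in> carrier (H i) \<and> s i = r i \<otimes>\<^bsub>H i\<^esub> t i" if "i \<in> X" "r i divides\<^bsub>H i\<^esub> s i" for i
    using that someI_ex[of "\<lambda>c. c \<in> carrier (H i) \<and> s i = r i \<otimes>\<^bsub>H i\<^esub> c"]
    unfolding t_def factor_def by auto
  have tP: "t \<in> carrier P"
  proof -
    have "t i \<in> carrier (H i)" if "i \<in> X" for i
      using t[OF that] monoid.one_closed[OF monoid_H[OF that]] that
      by (cases "r i divides\<^bsub>H i\<^esub> s i") (auto simp: t_def)
    moreover have "t \<in> extensional X"
      by (simp add: t_def)
    ultimately show ?thesis
      by (simp add: PiE_iff)
  qed
  have "eventually (\<lambda>i. s i = (r \<otimes>\<^bsub>P\<^esub> t) i) F"
    using ev eventually_mem by eventually_elim (use t in auto)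
  then have "cls s = cls r \<otimes>\<^bsub>M\<^esub> cls t"
    using r s tP m_closed_P by (simp add: cls_mult cls_eq_iff del: mult_product_group carrier_product_group)
  then show "cls r divides\<^bsub>M\<^esub> cls s"
    using cls_closed[OF tP] unfolding factor_def by blast
qed

lemma cls_divides_one:
  assumes "r \<in> carrier P"
  shows "cls r divides\<^bsub>M\<^esub> \<one>\<^bsub>M\<^esub> \<longleftrightarrow> eventually (\<lambda>i. r i divides\<^bsub>H i\<^esub> \<one>\<^bsub>H i\<^esub>) F"
  unfolding cls_one cls_divides[OF assms one_closed_P]
  by (rule eventually_cong_mem) simp

lemma cls_associated:
  assumes "r \<in> carrier P" "s \<in> carrier P"
  shows "cls r \<sim>\<^bsub>M\<^esub> cls s \<longleftrightarrow> eventually (\<lambda>i. r i \<sim>\<^bsub>H i\<^esub> s i) F"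
  unfolding associated_def cls_divides[OF assms] cls_divides[OF assms(2,1)] eventually_conj_iff ..

text \<open>A divisor witnessing that an element is not irreducible can be chosen component by
  component. Negating the existence of such witnesses moves the universal quantifier over divisors
  through the ultrafilter.\<close>

lemma cls_irreducible:
  assumes r: "r \<in> carrier P"
  shows "irreducible M (cls r) \<longleftrightarrow> eventually (\<lambda>i. irreducible (H i) (r i)) F"
proof -
  \<comment> \<open>A bad \<open>b\<close> is a proper divisor of \<open>r i\<close> that is not a
    unit; being a unit is written as dividing \<open>\<one>\<close>, so that
    \<open>cls_divides_one\<close> applies.\<close>
  define bad where "bad i b \<longleftrightarrow> b \<in> carrier (H i) \<and> b divides\<^bsub>H i\<^esub> r i \<and>
    \<not> r i divides\<^bsub>H i\<^esub> b \<and> \<not> b divides\<^bsub>H i\<^esub> \<one>\<^bsub>H i\<^esub>" for i b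
  have irr: "irreducible (H i) (r i) \<longleftrightarrow> \<not> r i divides\<^bsub>H i\<^esub> \<one>\<^bsub>H i\<^esub> \<and> \<not> (\<exists>b. bad i b)"
    if "i \<in> X" for i
    using comm_monoid.irreducible_iff_divides[OF comm_monoid_H carrier_P_apply[OF r]] that
    unfolding bad_def by blast
  have ev_bad: "eventually (\<lambda>i. bad i (b i)) F \<longleftrightarrow> cls b divides\<^bsub>M\<^esub> cls r \<and>
      \<not> cls r divides\<^bsub>M\<^esub> cls b \<and> \<not> cls b divides\<^bsub>M\<^esub> \<one>\<^bsub>M\<^esub>" if b: "b \<in> carrier P" for b
  proof -
    have "eventually (\<lambda>i. b i \<in> carrier (H i)) F"
      using eventually_mem by eventually_elim (use carrier_P_apply[OF b] in blast)
    then show ?thesis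
      unfolding bad_def eventually_conj_iff eventually_not cls_divides[OF b r]
        cls_divides[OF r b] cls_divides_one[OF b] by blast
  qed
  have ex_bad: "(\<exists>b\<in>carrier P. eventually (\<lambda>i. bad i (b i)) F) \<longleftrightarrow> eventually (\<lambda>i. \<exists>b. bad i b) F"
  proof
    assume "\<exists>b\<in>carrier P. eventually (\<lambda>i. bad i (b i)) F"
    then show "eventually (\<lambda>i. \<exists>b. bad i b) F"
      by (auto elim: eventually_mono)
  next
    assume ev: "eventually (\<lambda>i. \<exists>b. bad i b) F"
    \<comment> \<open>Components without a bad divisor receive \<open>\<one>\<close>, so that
      \<open>b\<close> is an element of the product.\<close>
    define b where "b = (\<lambda>i\<in>X. if \<exists>c. bad i c then SOME c. bad i c else \<one>\<^bsub>H i\<^esub>)"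
    have b: "bad i (b i)" if "i \<in> X" "\<exists>c. bad i c" for i
      using that someI_ex[of "bad i"] by (simp add: b_def)
    have "b \<in> carrier P"
      unfolding b_def
    proof (rule restrict_carrier_P)
      fix i assume "i \<in> X"
      then show "(if \<exists>c. bad i c then SOME c. bad i c else \<one>\<^bsub>H i\<^esub>) \<in> carrier (H i)"
        using someI_ex[of "bad i"] monoid.one_closed[OF monoid_H] by (auto simp: bad_def)
    qed
    moreover have "eventually (\<lambda>i. bad i (b i)) F"
      using ev eventually_mem by eventually_elim (use b in blast)
    ultimately show "\<exists>b\<in>carrier P. eventually (\<lambda>i. bad i (b i)) F"
      by blast
  qed
  have "irreducible M (cls r) \<longleftrightarrow> \<not> cls r divides\<^bsub>M\<^esub> \<one>\<^bsub>M\<^esub> \<and>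
      \<not> (\<exists>b\<in>carrier P. eventually (\<lambda>i. bad i (b i)) F)"
    unfolding M.irreducible_iff_divides[OF cls_closed[OF r]] carrier_M
    using ev_bad by blast
  also have "\<dots> \<longleftrightarrow> eventually (\<lambda>i. \<not> r i divides\<^bsub>H i\<^esub> \<one>\<^bsub>H i\<^esub> \<and> \<not> (\<exists>b. bad i b)) F"
    unfolding ex_bad cls_divides_one[OF r] eventually_conj_iff eventually_not ..
  also have "\<dots> \<longleftrightarrow> eventually (\<lambda>i. irreducible (H i) (r i)) F"
    by (rule eventually_cong_mem) (simp add: irr)
  finally show ?thesis .
qed

text \<open>The three claims go through the induction together: membership in the carrier is what
  makes \<open>cls_mult\<close> applicable to the next factor, and the last claim lets the product
  be evaluated in each component separately.\<close>

lemma foldr_P: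
  assumes "set ws \<subseteq> carrier P"
  shows "foldr (\<otimes>\<^bsub>M\<^esub>) (map cls ws) \<one>\<^bsub>M\<^esub> = cls (foldr (\<otimes>\<^bsub>P\<^esub>) ws \<one>\<^bsub>P\<^esub>) \<and>
    foldr (\<otimes>\<^bsub>P\<^esub>) ws \<one>\<^bsub>P\<^esub> \<in> carrier P \<and>
    (\<forall>i\<in>X. (foldr (\<otimes>\<^bsub>P\<^esub>) ws \<one>\<^bsub>P\<^esub>) i = foldr (\<otimes>\<^bsub>H i\<^esub>) (component ws i) \<one>\<^bsub>H i\<^esub>)"
  using assms
proof (induction ws)
  case Nil
  have "\<one>\<^bsub>P\<^esub> i = \<one>\<^bsub>H i\<^esub>" if "i \<in> X" for i
    using that by simp
  then show ?case
    using one_closed_P cls_one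
    by (simp add: component_def del: one_product_group carrier_product_group)
next
  case (Cons w ws)
  have w: "w \<in> carrier P" and ws: "set ws \<subseteq> carrier P"
    using Cons.prems by (simp_all del: carrier_product_group)
  note IH = Cons.IH[OF ws]
  let ?p = "foldr (\<otimes>\<^bsub>P\<^esub>) ws \<one>\<^bsub>P\<^esub>"
  have p: "?p \<in> carrier P"
    using IH by blast
  have fM: "foldr (\<otimes>\<^bsub>M\<^esub>) (map cls (w # ws)) \<one>\<^bsub>M\<^esub> = cls w \<otimes>\<^bsub>M\<^esub> cls ?p"
    using IH by (simp del: mult_product_group one_product_group carrier_product_group)
  have fP: "foldr (\<otimes>\<^bsub>P\<^esub>) (w # ws) \<one>\<^bsub>P\<^esub> = w \<otimes>\<^bsub>P\<^esub> ?p"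
    by simp
  show ?case
    unfolding fM fP cls_mult[OF w p]
  proof (intro conjI ballI refl m_closed_P[OF w p])
    fix i assume i: "i \<in> X"
    have "(w \<otimes>\<^bsub>P\<^esub> ?p) i = w i \<otimes>\<^bsub>H i\<^esub> ?p i"
      using i by simp
    also have "?p i = foldr (\<otimes>\<^bsub>H i\<^esub>) (component ws i) \<one>\<^bsub>H i\<^esub>"
      using IH i by blast
    finally show "(w \<otimes>\<^bsub>P\<^esub> ?p) i = foldr (\<otimes>\<^bsub>H i\<^esub>) (component (w # ws) i) \<one>\<^bsub>H i\<^esub>"
      by (simp add: component_def del: mult_product_group one_product_group)
  qed
qed

text \<open>A list has finitely many entries, so irreducibility of all of them can be tested on one
  common set of components; the equation for the product comes from \<open>foldr_P\<close>.\<close>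

lemma cls_factors:
  assumes ws: "set ws \<subseteq> carrier P" and r: "r \<in> carrier P"
  shows "factors M (map cls ws) (cls r) \<longleftrightarrow> eventually (\<lambda>i. factors (H i) (component ws i) (r i)) F"
proof -
  have "(\<forall>x\<in>set (map cls ws). irreducible M x) \<longleftrightarrow>
      (\<forall>w\<in>set ws. eventually (\<lambda>i. irreducible (H i) (w i)) F)"
    using ws cls_irreducible unfolding set_map ball_simps(9) by blast
  also have "\<dots> \<longleftrightarrow> eventually (\<lambda>i. \<forall>x\<in>set (component ws i). irreducible (H i) x) F"
    by (simp add: component_def eventually_ball_finite_distrib)
  finally have 1: "(\<forall>x\<in>set (map cls ws). irreducible M x) \<longleftrightarrow>
      eventually (\<lambda>i. \<forall>x\<in>set (component ws i). irreducible (H i) x) F" .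
  have "foldr (\<otimes>\<^bsub>M\<^esub>) (map cls ws) \<one>\<^bsub>M\<^esub> = cls r \<longleftrightarrow>
      eventually (\<lambda>i. (foldr (\<otimes>\<^bsub>P\<^esub>) ws \<one>\<^bsub>P\<^esub>) i = r i) F"
    using foldr_P[OF ws] cls_eq_iff[OF _ r] by metis
  also have "\<dots> \<longleftrightarrow>
      eventually (\<lambda>i. foldr (\<otimes>\<^bsub>H i\<^esub>) (component ws i) \<one>\<^bsub>H i\<^esub> = r i) F"
    using foldr_P[OF ws] by (intro eventually_cong_mem) metis
  finally show ?thesis
    unfolding factors_def eventually_conj_iff 1 by blast
qed

text \<open>For a fixed permutation, associatedness transfers at each of finitely many positions.
  The permutation found in component \<open>i\<close> may depend on \<open>i\<close>, but only
  finitely many occur, so one of them works almost everywhere.\<close>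

lemma cls_essentially_equal:
  assumes ws: "set ws \<subseteq> carrier P" and vs: "set vs \<subseteq> carrier P"
    and n: "length ws = n" "length vs = n"
  shows "essentially_equal M (map cls ws) (map cls vs) \<longleftrightarrow>
    eventually (\<lambda>i. essentially_equal (H i) (component ws i) (component vs i)) F"
proof -
  have fin: "finite {p. p permutes {..<n}}"
    by (rule finite_permutations) simp
  have len: "p k < n" if "p permutes {..<n}" "k < n" for p k
    using permutes_in_image[OF that(1)] that(2) by blast
  have "essentially_equal M (map cls ws) (map cls vs) \<longleftrightarrow>
      (\<exists>p\<in>{p. p permutes {..<n}}. \<forall>k\<in>{..<n}. map cls ws ! p k \<sim>\<^bsub>M\<^esub> map cls vs ! k)"
    by (rule essentially_equal_iff_permutes) (use n in auto)
  also have "\<dots> \<longleftrightarrow> (\<exists>p\<in>{p. p permutes {..<n}}. \<forall>k\<in>{..<n}.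
      eventually (\<lambda>i. component ws i ! p k \<sim>\<^bsub>H i\<^esub> component vs i ! k) F)"
  proof (intro bex_cong ball_cong refl)
    fix p k assume "p \<in> {p. p permutes {..<n}}" "k \<in> {..<n}"
    then have pk: "p k < length ws" "k < length vs"
      using len n by auto
    then have "ws ! p k \<in> carrier P" "vs ! k \<in> carrier P"
      using ws vs nth_mem by blast+
    from cls_associated[OF this] pk
    show "map cls ws ! p k \<sim>\<^bsub>M\<^esub> map cls vs ! k \<longleftrightarrow>
        eventually (\<lambda>i. component ws i ! p k \<sim>\<^bsub>H i\<^esub> component vs i ! k) F"
      by (simp add: component_def)
  qed
  also have "\<dots> \<longleftrightarrow> eventually (\<lambda>i. \<exists>p\<in>{p. p permutes {..<n}}. \<forall>k\<in>{..<n}.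
      component ws i ! p k \<sim>\<^bsub>H i\<^esub> component vs i ! k) F"
    unfolding eventually_bex_finite[OF fin] eventually_ball_finite_distrib[OF finite_lessThan] ..
  also have "\<dots> \<longleftrightarrow> eventually (\<lambda>i. essentially_equal (H i) (component ws i) (component vs i)) F"
    by (subst essentially_equal_iff_permutes[where n = n]) (use n in \<open>auto simp: component_def\<close>)
  finally show ?thesis .
qed

lemma map_cls_exhaust:
  assumes "set us \<subseteq> carrier M"
  obtains ws where "set ws \<subseteq> carrier P" "us = map cls ws"
proof -
  have "us \<in> lists (cls ` carrier P)"
    using assms unfolding carrier_M by blast
  then show thesis
    using that unfolding lists_image by blast
qed

lemma component_closed: "set ws \<subseteq> carrier P \<Longrightarrow> i \<in> X \<Longrightarrow> set (component ws i) \<subseteq> carrier (H i)"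
  unfolding component_def using carrier_P_apply by auto

lemma cls_factorizations:
  assumes "set ws \<subseteq> carrier P" "r \<in> carrier P" "length ws = n"
  shows "map cls ws \<in> factorizations M (cls r) n \<longleftrightarrow>
    eventually (\<lambda>i. component ws i \<in> factorizations (H i) (r i) n) F"
proof -
  have "map cls ws \<in> factorizations M (cls r) n \<longleftrightarrow> factors M (map cls ws) (cls r)"
    using assms cls_closed unfolding factorizations_def
    by (auto simp del: carrier_product_group)
  also have "\<dots> \<longleftrightarrow> eventually (\<lambda>i. component ws i \<in> factorizations (H i) (r i) n) F"
    unfolding cls_factors[OF assms(1,2)] factorizations_def
    using component_closed[OF assms(1)] assms(3)
    by (intro eventually_cong_mem) (auto simp: component_def)
  finally show ?thesis .
qed

section \<open>Sections of factorizations and the number of classes\<close>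

text \<open>Local lists of the common length \<open>n\<close> are glued position by position into a
  list over the product; \<open>Q\<close> marks the components in which a list is
  prescribed.\<close>

lemma ex_component:
  assumes "\<And>i. i \<in> X \<Longrightarrow> Q i \<Longrightarrow> set (w i) \<subseteq> carrier (H i) \<and> length (w i) = n"
  obtains ws where "set ws \<subseteq> carrier P" "length ws = n"
    "\<And>i. i \<in> X \<Longrightarrow> Q i \<Longrightarrow> component ws i = w i"
proof
  \<comment> \<open>Outside \<open>Q\<close> every entry is \<open>\<one>\<close>, so the glued
    functions still lie in the product.\<close>
  let ?f = "\<lambda>k i. if Q i then w i ! k else \<one>\<^bsub>H i\<^esub>"
  let ?ws = "map (\<lambda>k. restrict (?f k) X) [0..<n]"
  have "restrict (?f k) X \<in> carrier P" if "k < n" for k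
  proof (rule restrict_carrier_P)
    fix i assume i: "i \<in> X"
    show "?f k i \<in> carrier (H i)"
      using assms[OF i] nth_mem[of k "w i"] that monoid.one_closed[OF monoid_H[OF i]]
      by (auto simp del: nth_mem)
  qed
  then show "set ?ws \<subseteq> carrier P"
    by (auto simp del: carrier_product_group)
  show "length ?ws = n"
    by simp
  show "component ?ws i = w i" if "i \<in> X" "Q i" for i
    using assms[OF that] that by (auto simp: component_def intro!: nth_equalityI)
qed

text \<open>Each \<open>\<alpha>\<close> becomes a section that follows, wherever
  \<open>\<alpha> \<in> B i\<close>, the class assigned to \<open>\<alpha>\<close> by an injection
  of \<open>B i\<close>. The sets \<open>B i\<close> may vary with \<open>i\<close>. If two sections
  are essentially equal almost everywhere, they are so in a component containing both indices, where
  injectivity identifies the indices.\<close>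

lemma card_le_classes:
  assumes r: "r \<in> carrier P"
    and B: "\<And>i. i \<in> X \<Longrightarrow> |B i| \<le>o |factorization_classes (H i) (r i) n|"
    and A: "\<And>\<alpha>. \<alpha> \<in> A \<Longrightarrow> eventually (\<lambda>i. \<alpha> \<in> B i) F"
  shows "|A| \<le>o |factorization_classes M (cls r) n|"
proof -
  have "\<forall>i\<in>X. \<exists>f. inj_on f (B i) \<and> f ` B i \<subseteq> factorization_classes (H i) (r i) n"
    using B card_of_ordLeq by blast
  from bchoice[OF this] obtain f where f: "\<And>i. i \<in> X \<Longrightarrow> inj_on (f i) (B i)"
    "\<And>i \<alpha>. i \<in> X \<Longrightarrow> \<alpha> \<in> B i \<Longrightarrow> f i \<alpha> \<in> factorization_classes (H i) (r i) n"
    by blast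
  have "\<exists>w. w \<in> factorizations (H i) (r i) n \<and> f i \<alpha> = same_factorization (H i) (r i) n `` {w}"
    if "i \<in> X" "\<alpha> \<in> B i" for i \<alpha>
    using f(2)[OF that] by (auto elim: quotientE)
  then obtain w where w: "\<And>i \<alpha>. i \<in> X \<Longrightarrow> \<alpha> \<in> B i \<Longrightarrow> w i \<alpha> \<in> factorizations (H i) (r i) n"
    "\<And>i \<alpha>. i \<in> X \<Longrightarrow> \<alpha> \<in> B i \<Longrightarrow> f i \<alpha> = same_factorization (H i) (r i) n `` {w i \<alpha>}"
    by metis
  have "\<exists>ws. set ws \<subseteq> carrier P \<and> length ws = n \<and>
      (\<forall>i\<in>X. \<alpha> \<in> B i \<longrightarrow> component ws i = w i \<alpha>)" for \<alpha>
    by (rule ex_component[of "\<lambda>i. \<alpha> \<in> B i" "\<lambda>i. w i \<alpha>" n])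
      (use w(1) in \<open>auto simp: factorizations_def\<close>)
  then obtain ws where ws: "\<And>\<alpha>. set (ws \<alpha>) \<subseteq> carrier P" "\<And>\<alpha>. length (ws \<alpha>) = n"
    "\<And>i \<alpha>. i \<in> X \<Longrightarrow> \<alpha> \<in> B i \<Longrightarrow> component (ws \<alpha>) i = w i \<alpha>"
    by metis
  have fact: "map cls (ws \<alpha>) \<in> factorizations M (cls r) n" if "\<alpha> \<in> A" for \<alpha>
    unfolding cls_factorizations[OF ws(1) r ws(2)]
    using A[OF that] eventually_mem by eventually_elim (use ws(3) w(1) in simp)
  define g where "g \<alpha> = same_factorization M (cls r) n `` {map cls (ws \<alpha>)}" for \<alpha>
  have "inj_on g A"
  proof (rule inj_onI)
    fix \<alpha> \<beta> assume \<alpha>\<beta>: "\<alpha> \<in> A" "\<beta> \<in> A" and "g \<alpha> = g \<beta>"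
    then have "(map cls (ws \<alpha>), map cls (ws \<beta>)) \<in> same_factorization M (cls r) n"
      unfolding g_def
      using eq_equiv_class_iff[OF M.equiv_same_factorization fact[OF \<alpha>\<beta>(1)] fact[OF \<alpha>\<beta>(2)]]
      by blast
    then have "eventually (\<lambda>i. essentially_equal (H i) (component (ws \<alpha>) i) (component (ws \<beta>) i)) F"
      using cls_essentially_equal[OF ws(1) ws(1) ws(2) ws(2)]
      unfolding same_factorization_def by blast
    with A[OF \<alpha>\<beta>(1)] A[OF \<alpha>\<beta>(2)] eventually_mem have "eventually (\<lambda>i. \<alpha> = \<beta>) F"
    proof eventually_elim
      case (elim i)
      then have "essentially_equal (H i) (w i \<alpha>) (w i \<beta>)"
        using ws(3) by simp
      then have "(w i \<alpha>, w i \<beta>) \<in> same_factorization (H i) (r i) n"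
        using w(1) elim unfolding same_factorization_def by blast
      then have "f i \<alpha> = f i \<beta>"
        unfolding w(2)[OF elim(3,1)] w(2)[OF elim(3,2)]
        by (rule equiv_class_eq[OF comm_monoid_cancel.equiv_same_factorization[OF factor_monoid[OF elim(3)]]])
      then show ?case
        using f(1) elim by (meson inj_onD)
    qed
    \<comment> \<open>The equation does not depend on \<open>i\<close>, so its failure would put the
      empty set into \<open>\<U>\<close>.\<close>
    then show "\<alpha> = \<beta>"
      using ultrafilter by (cases "\<alpha> = \<beta>") (auto simp: eventually_F ultrafilter_on_def)
  qed
  moreover have "g ` A \<subseteq> factorization_classes M (cls r) n"
    unfolding g_def using fact by (auto intro: quotientI)
  ultimately show ?thesis
    using card_of_ordLeq by blast
qed

text \<open>One finite set \<open>A\<close> lists the classes of every component and thereby yields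
  finitely many sections. A factorization in the ultraproduct follows some listed class in almost
  every component, and finiteness of \<open>A\<close> makes the index the same almost everywhere, so
  its class is that of a section.\<close>

lemma classes_card_le:
  assumes r: "r \<in> carrier P" and A: "finite A"
    and Z: "\<And>i. i \<in> X \<Longrightarrow> |factorization_classes (H i) (r i) n| \<le>o |A|"
  shows "|factorization_classes M (cls r) n| \<le>o |A|"
proof -
  have "\<forall>i\<in>X. \<exists>f. factorization_classes (H i) (r i) n \<subseteq> f ` A"
  proof
    fix i assume "i \<in> X"
    note Zi = Z[OF this]
    show "\<exists>f. factorization_classes (H i) (r i) n \<subseteq> f ` A"
    \<comment> \<open>\<open>card_of_ordLeq2\<close> provides a map from \<open>A\<close> onto a
      nonempty set only; with no classes to cover, any map will do.\<close>
    proof (cases "factorization_classes (H i) (r i) n = {}")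
      case False
      then obtain f where "f ` A = factorization_classes (H i) (r i) n"
        using Zi card_of_ordLeq2[OF False, of A] by blast
      then show ?thesis
        by blast
    qed simp
  qed
  from bchoice[OF this] obtain f
    where f: "\<And>i. i \<in> X \<Longrightarrow> factorization_classes (H i) (r i) n \<subseteq> f i ` A"
    by blast
  \<comment> \<open>Since \<open>f i\<close> is only known to cover the classes, it may also take
    other values; \<open>Q\<close> restricts the choice of representatives to values that are
    classes.\<close>
  define Q where "Q \<alpha> i \<longleftrightarrow> f i \<alpha> \<in> factorization_classes (H i) (r i) n" for \<alpha> i
  have "\<exists>w. w \<in> factorizations (H i) (r i) n \<and> f i \<alpha> = same_factorization (H i) (r i) n `` {w}"
    if "Q \<alpha> i" for i \<alpha>
    using that unfolding Q_def by (auto elim: quotientE)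
  then have "\<forall>i \<alpha>. \<exists>w. Q \<alpha> i \<longrightarrow> w \<in> factorizations (H i) (r i) n \<and>
      f i \<alpha> = same_factorization (H i) (r i) n `` {w}"
    by blast
  then obtain w where "\<forall>i \<alpha>. Q \<alpha> i \<longrightarrow> w i \<alpha> \<in> factorizations (H i) (r i) n \<and>
      f i \<alpha> = same_factorization (H i) (r i) n `` {w i \<alpha>}"
    unfolding choice_iff by blast
  then have w: "\<And>i \<alpha>. Q \<alpha> i \<Longrightarrow> w i \<alpha> \<in> factorizations (H i) (r i) n"
    "\<And>i \<alpha>. Q \<alpha> i \<Longrightarrow> f i \<alpha> = same_factorization (H i) (r i) n `` {w i \<alpha>}"
    by blast+
  have "\<exists>ws. set ws \<subseteq> carrier P \<and> length ws = n \<and>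
      (\<forall>i\<in>X. Q \<alpha> i \<longrightarrow> component ws i = w i \<alpha>)" for \<alpha>
    by (rule ex_component[of "Q \<alpha>" "\<lambda>i. w i \<alpha>" n])
      (use w(1) in \<open>auto simp: factorizations_def\<close>)
  then obtain ws where ws: "\<And>\<alpha>. set (ws \<alpha>) \<subseteq> carrier P" "\<And>\<alpha>. length (ws \<alpha>) = n"
    "\<And>i \<alpha>. i \<in> X \<Longrightarrow> Q \<alpha> i \<Longrightarrow> component (ws \<alpha>) i = w i \<alpha>"
    by metis
  define g where "g \<alpha> = same_factorization M (cls r) n `` {map cls (ws \<alpha>)}" for \<alpha>
  have "factorization_classes M (cls r) n \<subseteq> g ` A"
  proof
    fix C assume "C \<in> factorization_classes M (cls r) n"
    then obtain us where us: "us \<in> factorizations M (cls r) n"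
      and C: "C = same_factorization M (cls r) n `` {us}"
      by (auto elim: quotientE)
    then obtain vs where vs: "set vs \<subseteq> carrier P" "us = map cls vs"
      using map_cls_exhaust unfolding factorizations_def by blast
    have n: "length vs = n"
      using us unfolding vs(2) factorizations_def by simp
    have "eventually (\<lambda>i. component vs i \<in> factorizations (H i) (r i) n) F"
      using us cls_factorizations[OF vs(1) r n] unfolding vs(2) by blast
    with eventually_mem have "eventually (\<lambda>i. \<exists>\<alpha>\<in>A. Q \<alpha> i \<and>
        essentially_equal (H i) (component vs i) (component (ws \<alpha>) i)) F"
    proof eventually_elim
      case (elim i)
      interpret Hi: comm_monoid_cancel "H i"
        by (rule factor_monoid[OF elim(1)])
      let ?C = "same_factorization (H i) (r i) n `` {component vs i}"
      have C: "?C \<in> factorization_classes (H i) (r i) n"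
        by (rule quotientI[OF elim(2)])
      obtain \<alpha> where \<alpha>: "\<alpha> \<in> A" "?C = f i \<alpha>"
        using subsetD[OF f[OF elim(1)] C] by (rule imageE)
      have Q: "Q \<alpha> i"
        using C unfolding Q_def \<alpha>(2) .
      have "(component vs i, w i \<alpha>) \<in> same_factorization (H i) (r i) n"
        using \<alpha>(2) unfolding w(2)[OF Q]
          eq_equiv_class_iff[OF Hi.equiv_same_factorization elim(2) w(1)[OF Q]] .
      then show ?case
        using \<alpha>(1) Q unfolding ws(3)[OF elim(1) Q, symmetric] same_factorization_def
        by blast
    qed
    \<comment> \<open>So far the index varied with the component; here finiteness of
      \<open>A\<close> fixes it.\<close>
    then obtain \<alpha> where \<alpha>: "\<alpha> \<in> A" and ev: "eventually (\<lambda>i. Q \<alpha> i \<and>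
        essentially_equal (H i) (component vs i) (component (ws \<alpha>) i)) F"
      unfolding eventually_bex_finite[OF A] by blast
    have "essentially_equal M (map cls vs) (map cls (ws \<alpha>))"
      unfolding cls_essentially_equal[OF vs(1) ws(1) n ws(2)]
      using ev by eventually_elim blast
    moreover have "map cls (ws \<alpha>) \<in> factorizations M (cls r) n"
      unfolding cls_factorizations[OF ws(1) r ws(2)]
      using ev eventually_mem by eventually_elim (use ws(3) w(1) in simp)
    ultimately have "(us, map cls (ws \<alpha>)) \<in> same_factorization M (cls r) n"
      using us unfolding vs(2) same_factorization_def by blast
    then have "C = g \<alpha>"
      unfolding C g_def by (rule equiv_class_eq[OF M.equiv_same_factorization])
    then show "C \<in> g ` A"
      using \<alpha> by blast
  qed
  then show ?thesis
    by (rule ordLeq_transitive[OF card_of_mono1 card_of_image])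
qed

end

section \<open>Small sets and complete nonprincipal ultrafilters\<close>

text \<open>No singleton of a point of \<open>X\<close> lies in \<open>\<U>\<close>, which would
  otherwise be principal. Hence \<open>X - A\<close> is an intersection of fewer than
  \<open>\<kappa>\<close> members of \<open>\<U>\<close>, namely the complements of the points of
  \<open>A\<close>.\<close>

lemma diff_small_in_ultrafilter:
  assumes U: "ultrafilter_on X \<U>" "nonprincipal_on X \<U>" "complete_on X \<kappa> \<U>"
    and A: "A \<subseteq> X" "|A| <o \<kappa>"
  shows "X - A \<in> \<U>"
proof -
  note UD = ultrafilter_onD[OF U(1)]
  have sing: "X - {x} \<in> \<U>" if x: "x \<in> X" for x
  proof (rule ccontr)
    assume "X - {x} \<notin> \<U>"
    then have xU: "{x} \<in> \<U>"
      using UD(5)[of "{x}"] x by simp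
    have "B \<in> \<U> \<longleftrightarrow> B \<subseteq> X \<and> x \<in> B" for B
    proof
      assume B: "B \<in> \<U>"
      then have "B \<inter> {x} \<noteq> {}"
        using UD(3)[OF B xU] UD(2) by metis
      with UD(1)[OF B] show "B \<subseteq> X \<and> x \<in> B"
        by simp
    next
      assume "B \<subseteq> X \<and> x \<in> B"
      then show "B \<in> \<U>"
        using UD(4)[OF xU] by simp
    qed
    then have "\<U> = {A. A \<subseteq> X \<and> x \<in> A}"
      by blast
    then show False
      using U(2) x unfolding nonprincipal_on_def by blast
  qed
  let ?F = "(\<lambda>x. X - {x}) ` A"
  have "|?F| <o \<kappa>"
    using card_of_image A(2) ordLeq_ordLess_trans by blast
  moreover have "?F \<subseteq> \<U>"
    using sing A(1) by blast
  ultimately have "X \<inter> \<Inter>?F \<in> \<U>"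
    using U(3) unfolding complete_on_def by blast
  moreover have "X \<inter> \<Inter>?F = X - A"
    by auto
  ultimately show ?thesis
    by simp
qed

text \<open>In a finite field every proper subset is small. With at least two points, a singleton
  and its complement would then both lie in \<open>\<U>\<close>; with one point, \<open>\<U>\<close>
  would be principal. Infinity places singletons and finite multiplicities strictly below the
  cardinal.\<close>

lemma infinite_Field_nonprincipal:
  assumes U: "ultrafilter_on (Field \<kappa>) \<U>" "nonprincipal_on (Field \<kappa>) \<U>"
      "complete_on (Field \<kappa>) \<kappa> \<U>"
    and \<kappa>: "Card_order \<kappa>"
  shows "infinite (Field \<kappa>)"
proof
  assume fin: "finite (Field \<kappa>)"
  note UD = ultrafilter_onD[OF U(1)]
  have "Field \<kappa> \<noteq> {}"
    using U(1) unfolding ultrafilter_on_def by auto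
  then obtain x where x: "x \<in> Field \<kappa>"
    by blast
  have less: "|B| <o \<kappa>" if "B \<subset> Field \<kappa>" for B
  proof -
    have "finite B"
      using fin that finite_subset by blast
    then have "\<not> (\<exists>f. inj_on f (Field \<kappa>) \<and> f ` Field \<kappa> \<subseteq> B)"
      using psubset_card_mono[OF fin that] card_inj_on_le leD by blast
    then have "|B| <o |Field \<kappa>|"
      using card_of_ordLess by blast
    then show ?thesis
      using card_of_Field_ordIso[OF \<kappa>] ordLess_ordIso_trans by blast
  qed
  show False
  proof (cases "Field \<kappa> = {x}")
    case True
    have "A \<in> \<U> \<longleftrightarrow> A \<subseteq> {x} \<and> x \<in> A" for A
    proof -
      have "A = {} \<or> A = {x}" if "A \<subseteq> {x}"
        using that by blast
      moreover have "{x} \<in> \<U>"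
        using U(1) unfolding ultrafilter_on_def True by simp
      ultimately show ?thesis
        using UD(1)[of A] UD(2) True by auto
    qed
    then have "\<U> = {A. A \<subseteq> Field \<kappa> \<and> x \<in> A}"
      unfolding True by blast
    then show False
      using U(2) x unfolding nonprincipal_on_def by blast
  next
    case False
    let ?Y = "Field \<kappa> - {x}"
    have "?Y \<in> \<U>"
      using x False by (intro diff_small_in_ultrafilter[OF U] less; blast)
    moreover have "Field \<kappa> - ?Y \<in> \<U>"
      using x by (intro diff_small_in_ultrafilter[OF U] less; blast)
    ultimately have "?Y \<inter> (Field \<kappa> - ?Y) \<in> \<U>"
      by (rule UD(3))
    moreover have "?Y \<inter> (Field \<kappa> - ?Y) = {}"
      by blast
    ultimately show False
      using UD(2) by simp
  qed
qed

section \<open>Prescribing multiplicities in the components\<close>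

theorem theorem3:
  fixes \<Lambda> :: "'l rel"
    and \<U> :: "'l set set"
    and H :: "'l \<Rightarrow> ('a, 'm) monoid_scheme"
  assumes "measurable_cardinal \<Lambda>"
    and "ultrafilter_on (Field \<Lambda>) \<U>"
    and "nonprincipal_on (Field \<Lambda>) \<U>"
    and "complete_on (Field \<Lambda>) \<Lambda> \<U>"
    and "\<And>i. i \<in> Field \<Lambda> \<Longrightarrow> comm_monoid_cancel (H i)"
    and "\<And>i (L :: nat \<Rightarrow> 'l rel). i \<in> Field \<Lambda> \<Longrightarrow>
           (\<And>n. n \<ge> 2 \<Longrightarrow> Card_order (L n) \<and> L n <o \<Lambda>) \<Longrightarrow>
           \<exists>r\<in>carrier (H i). \<forall>n\<ge>2.
             L n \<le>o length_multiplicity (H i) r n \<and>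
             (finite (Field (L n)) \<longrightarrow> length_multiplicity (H i) r n =o L n)"
  shows "\<forall>L :: nat \<Rightarrow> 'l rel.
           (\<forall>n\<ge>2. Card_order (L n) \<and> L n \<le>o \<Lambda> \<and>
              (finite (Field (L n)) \<or> countable (Field (L n)) \<or> limit_cardinal (L n))) \<longrightarrow>
           (\<exists>r\<in>carrier (ultraproduct (Field \<Lambda>) \<U> H). \<forall>n\<ge>2.
             L n \<le>o length_multiplicity (ultraproduct (Field \<Lambda>) \<U> H) r n \<and>
             (finite (Field (L n)) \<longrightarrow>
                length_multiplicity (ultraproduct (Field \<Lambda>) \<U> H) r n =o L n))"
proof (intro allI impI)
  let ?X = "Field \<Lambda>"
  fix L :: "nat \<Rightarrow> 'l rel"
  assume L: "\<forall>n\<ge>2. Card_order (L n) \<and> L n \<le>o \<Lambda> \<and>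
    (finite (Field (L n)) \<or> countable (Field (L n)) \<or> limit_cardinal (L n))"
  interpret monoid_ultraproduct ?X \<U> H
    by (rule monoid_ultraproduct.intro[OF assms(2,5)])
  have \<Lambda>: "Card_order \<Lambda>"
    using assms(1) unfolding measurable_cardinal_def by blast
  have inf: "infinite ?X"
    by (rule infinite_Field_nonprincipal[OF assms(2-4) \<Lambda>])
  \<comment> \<open>As \<open>L n \<le>o \<Lambda>\<close> for \<open>n \<ge> 2\<close>, the second
    branch is the case \<open>L n =o \<Lambda>\<close>, in which the hypothesis on
    \<open>H i\<close> does not admit \<open>L n\<close> itself, but does admit the smaller
    cardinality of \<open>underS \<Lambda> i\<close>. Sets are used instead of cardinals because
    their elements serve as indices of sections.\<close>
  define B where "B n i = (if L n <o \<Lambda> then Field (L n) else underS \<Lambda> i)" for n i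
  have LF: "|Field (L n)| =o L n" if "n \<ge> 2" for n
    using L that card_of_Field_ordIso by blast
  have B_less: "|B n i| <o \<Lambda>" if "n \<ge> 2" "i \<in> ?X" for n i
    using LF[OF that(1)] card_of_underS[OF \<Lambda> that(2)] ordIso_ordLess_trans
    unfolding B_def by auto
  \<comment> \<open>The hypothesis is applied to all lengths at once, so one element of
    \<open>H i\<close> serves every \<open>n\<close>.\<close>
  have "\<exists>r\<in>carrier (H i). \<forall>n\<ge>2. |B n i| \<le>o length_multiplicity (H i) r n \<and>
      (finite (Field |B n i| ) \<longrightarrow> length_multiplicity (H i) r n =o |B n i| )" if "i \<in> ?X" for i
    by (rule assms(6)[OF that]) (use B_less card_of_Card_order that in blast)
  then obtain s where s: "\<And>i. i \<in> ?X \<Longrightarrow> s i \<in> carrier (H i)"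
    "\<And>i n. i \<in> ?X \<Longrightarrow> n \<ge> 2 \<Longrightarrow> |B n i| \<le>o length_multiplicity (H i) (s i) n"
    "\<And>i n. i \<in> ?X \<Longrightarrow> n \<ge> 2 \<Longrightarrow> finite (B n i) \<Longrightarrow>
      length_multiplicity (H i) (s i) n =o |B n i|"
    unfolding Field_card_of by metis
  define r where "r = restrict s ?X"
  have r: "r \<in> carrier P"
    unfolding r_def using s(1) by (rule restrict_carrier_P)
  have rs: "r i = s i" if "i \<in> ?X" for i
    using that by (simp add: r_def)
  show "\<exists>r\<in>carrier M. \<forall>n\<ge>2. L n \<le>o length_multiplicity M r n \<and>
      (finite (Field (L n)) \<longrightarrow> length_multiplicity M r n =o L n)"
  proof (intro bexI[of _ "cls r"] allI impI conjI cls_closed[OF r])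
    fix n :: nat assume n: "n \<ge> 2"
    have Bi: "|B n i| \<le>o |factorization_classes (H i) (r i) n|" if "i \<in> ?X" for i
      using s(2)[OF that n] rs[OF that] unfolding length_multiplicity_def by simp
    show le: "L n \<le>o length_multiplicity M (cls r) n"
    proof (cases "L n <o \<Lambda>")
      case True
      \<comment> \<open>Here \<open>B n i\<close> is the same set for all \<open>i\<close>, so every
        index is present in every component.\<close>
      have "|Field (L n)| \<le>o |factorization_classes M (cls r) n|"
        using Bi by (rule card_le_classes[OF r]) (simp_all add: B_def True)
      then show ?thesis
        using LF[OF n] ordIso_ordLeq_trans ordIso_symmetric
        unfolding length_multiplicity_def by blast
    next
      case False
      have "|?X| \<le>o |factorization_classes M (cls r) n|"
        using Bi
      proof (rule card_le_classes[OF r])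
        \<comment> \<open>The index \<open>\<alpha>\<close> is present exactly in the components
          strictly above it. Those left out form \<open>underS \<Lambda> \<alpha>\<close> and the
          point \<open>\<alpha>\<close>, both smaller than \<open>\<Lambda>\<close>.\<close>
        fix \<alpha> assume \<alpha>: "\<alpha> \<in> ?X"
        have "underS \<Lambda> \<alpha> \<subseteq> ?X"
          unfolding underS_def Field_def by auto
        then have "?X - underS \<Lambda> \<alpha> \<in> \<U>"
          using card_of_underS[OF \<Lambda> \<alpha>] by (rule diff_small_in_ultrafilter[OF assms(2-4)])
        moreover have "?X - {\<alpha>} \<in> \<U>"
        proof (rule diff_small_in_ultrafilter[OF assms(2-4)])
          show "{\<alpha>} \<subseteq> ?X"
            using \<alpha> by simp
          show "|{\<alpha>}| <o \<Lambda>"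
          proof (rule finite_ordLess_infinite[OF card_of_Well_order])
            show "Well_order \<Lambda>"
              using \<Lambda> unfolding card_order_on_def by blast
          qed (simp_all add: Field_card_of inf)
        qed
        ultimately have "(?X - underS \<Lambda> \<alpha>) \<inter> (?X - {\<alpha>}) \<in> \<U>"
          by (rule ultrafilter_onD(3)[OF assms(2)])
        moreover have "(?X - underS \<Lambda> \<alpha>) \<inter> (?X - {\<alpha>}) \<subseteq> {i \<in> ?X. \<alpha> \<in> underS \<Lambda> i}"
          using \<alpha> \<Lambda> wo_rel.TOTALS[of \<Lambda>]
          unfolding underS_def card_order_on_def wo_rel_def by auto
        ultimately have "{i \<in> ?X. \<alpha> \<in> underS \<Lambda> i} \<in> \<U>"
          by (rule ultrafilter_onD(4)[OF assms(2)]) blast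
        then show "eventually (\<lambda>i. \<alpha> \<in> B n i) F"
          using False by (simp add: eventually_F B_def)
      qed
      moreover have "L n \<le>o |?X|"
        using L n card_of_Field_ordIso[OF \<Lambda>] ordLeq_ordIso_trans ordIso_symmetric by blast
      ultimately show ?thesis
        using ordLeq_transitive unfolding length_multiplicity_def by blast
    qed
    assume fin: "finite (Field (L n))"
    \<comment> \<open>A finite multiplicity lies below the infinite \<open>\<Lambda>\<close>, so
      every component was given \<open>L n\<close> itself, and \<open>Field (L n)\<close> is the
      common finite index set that \<open>classes_card_le\<close> asks for.\<close>
    have "L n <o \<Lambda>"
      using finite_ordLess_infinite[OF _ _ fin inf] L n \<Lambda> unfolding card_order_on_def by blast
    then have Bn: "B n i = Field (L n)" for i
      by (simp add: B_def)
    have "|factorization_classes M (cls r) n| \<le>o |Field (L n)|"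
    proof (rule classes_card_le[OF r fin])
      fix i assume i: "i \<in> ?X"
      then show "|factorization_classes (H i) (r i) n| \<le>o |Field (L n)|"
        using s(3)[OF i n] fin rs ordIso_imp_ordLeq unfolding Bn length_multiplicity_def by simp
    qed
    then have "length_multiplicity M (cls r) n \<le>o L n"
      using LF[OF n] ordLeq_ordIso_trans unfolding length_multiplicity_def by blast
    then show "length_multiplicity M (cls r) n =o L n"
      using le ordIso_iff_ordLeq by blast
  qed
qed

end
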